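(* The momentum map $\mathbf{J}:\mathbb{S}^J\to(\mathfrak{g}^J)^*$ of the Jacobi group action specified in the context is a diffeomorphism onto a coadjoint orbit $\mathcal{O}$ of $G^J(\mathbb{R})$, and it satisfies $\mathbf{J}^*\omega_{\mathcal{O}}=\omega_{KB}$, where $\omega_{\mathcal{O}}$ is the Kirillov-Kostant-Souriau symplectic form and $\omega_{KB}$ the Kähler-Berndt symplectic form. In other words, the Siegel-Jacobi space $\mathbb{S}^J$ (regarded as a symplectic manifold) is a coadjoint orbit of the Jacobi group $G^J(\mathbb{R})$.
   Context: The Siegel-Jacobi space $\mathbb{S}^J$ is the complex manifold $\mathbb{H}\times\mathbb{C}$ ($\mathbb{H}$ the upper half-plane) with the Kähler metric $g_{KB}$ whose matrix in the coordinates $(u,v,x,y)$ ($\tau=u+iv\in\mathbb{H}$, $z=x+iy\in\mathbb{C}$) is $$\frac12\begin{bmatrix}\frac{v+y^2}{v^3}&0&-\frac{y}{v^2}&0\\0&\frac{v+y^2}{v^3}&0&-\frac{y}{v^2}\\-\frac{y}{v^2}&0&\frac1v&0\\0&-\frac{y}{v^2}&0&\frac1v\end{bmatrix},$$ and symplectic form $\omega_{KB}=g_{KB}(J\cdot,\cdot)$, $J$ being the complex structure. Coordinates $(\theta_1,\theta_2,\dot\theta_1,\dot\theta_2)$ on $\mathbb{S}^J$ ($\theta_2<0$) are defined by $\tau=\dot\theta_2-i\theta_2$, $z=-\dot\theta_1+i\theta_1$, and $\eta_1=-\frac{\theta_1}{2\theta_2}$, $\eta_2=\frac{\theta_1^2-2\theta_2}{4\theta_2^2}$.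 The Jacobi group $G^J(\mathbb{R})$ is $\mathrm{SL}(2,\mathbb{R})\times\mathbb{R}^2\times\mathbb{R}$ with multiplication $(M_1,X_1,\kappa_1)\cdot(M_2,X_2,\kappa_2)=(M_1M_2,X_1M_2+X_2,\kappa_1+\kappa_2+\Omega(X_1M_2,X_2))$ (row vectors $X_i$; $\Omega(\xi,\eta)=\xi_1\eta_2-\xi_2\eta_1$), acting on $\mathbb{H}\times\mathbb{C}$ by $\big(\big[\begin{smallmatrix}a&b\\c&d\end{smallmatrix}\big],(\lambda,\mu,\kappa)\big)\cdot(\tau,z)=\big(\frac{a\tau+b}{c\tau+d},\frac{z+\lambda\tau+\mu}{c\tau+d}\big)$. Its Lie algebra is $\mathfrak{g}^J=\mathfrak{sl}(2,\mathbb{R})\times\mathbb{R}^2\times\mathbb{R}$ with bracket $[(A,\xi,r),(B,\eta,s)]=([A,B],\xi B-\eta A,2\Omega(\xi,\eta))$ and basis $F=\big[\begin{smallmatrix}0&1\\0&0\end{smallmatrix}\big]$, $G=\big[\begin{smallmatrix}0&0\\1&0\end{smallmatrix}\big]$, $H=\big[\begin{smallmatrix}1&0\\0&-1\end{smallmatrix}\big]$ in $\mathfrak{sl}(2,\mathbb{R})$, $P=(1,0,0)$, $Q=(0,1,0)$, $R=(0,0,1)$ in $\mathbb{R}^2\times\mathbb{R}$. The momentum map $\mathbf{J}$ is determined, writing $\mathbf{J}^L(p)=\mathbf{J}(p)(L)$, by linearity in $L$ and $\mathbf{J}^F=-\eta_2$, $\mathbf{J}^G=\frac14\dot\theta_1^2+\eta_2\dot\theta_2^2+\eta_1\dot\theta_1\dot\theta_2-\frac{1}{4(\eta_1^2-\eta_2)}$,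 $\mathbf{J}^H=-\eta_1\dot\theta_1-2\eta_2\dot\theta_2$, $\mathbf{J}^P=\frac12\dot\theta_1+\eta_1\dot\theta_2$, $\mathbf{J}^Q=\eta_1$, $\mathbf{J}^R=-\frac14$. For a Lie group with Lie algebra $\mathfrak{g}$, the coadjoint representation is $\langle\mathrm{Ad}^*(g)\alpha,\xi\rangle=\langle\alpha,\mathrm{Ad}(g^{-1})\xi\rangle$; the coadjoint orbit $\mathcal{O}$ of $\mu\in\mathfrak{g}^*$ is $\{\mathrm{Ad}^*(g)\mu\}$, an immersed submanifold with tangent space $\{\mathrm{ad}^*(\xi)(\alpha)\mid\xi\in\mathfrak{g}\}$ at $\alpha$, where $\langle\mathrm{ad}^*(\xi)(\alpha),\eta\rangle=\langle\alpha,[\xi,\eta]\rangle$; and $(\omega_{\mathcal{O}})_\alpha(\mathrm{ad}^*(\xi)(\alpha),\mathrm{ad}^*(\eta)(\alpha))=\langle\alpha,[\xi,\eta]\rangle$. *)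

theory Defs
  imports "HOL-Analysis.Analysis" "HOL-Algebra.Group"
begin

text \<open>On an open subset \<open>U\<close> of a finite-dimensional space, \<open>Ck_on n U f\<close> says that \<open>f\<close> is of
  class \<open>C\<^sup>n\<close>: iterated directional derivatives exist up to order \<open>n\<close> and are continuous.\<close>

fun Ck_on :: "nat \<Rightarrow> 'a::euclidean_space set \<Rightarrow> ('a \<Rightarrow> 'b::real_normed_vector) \<Rightarrow> bool" where
  "Ck_on 0 U f \<longleftrightarrow> continuous_on U f"
| "Ck_on (Suc n) U f \<longleftrightarrow> (\<forall>x\<in>U. f differentiable (at x)) \<and>
     (\<forall>v. Ck_on n U (\<lambda>x. frechet_derivative f (at x) v))"

text \<open>On an arbitrary subset \<open>S\<close>, smooth means locally the restriction of a smooth map on an open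
  set.  For an embedded submanifold \<open>S\<close> (such as \<open>SL(2,\<real>) \<times> \<real>\<^sup>2 \<times> \<real>\<close> below) this is the usual notion.\<close>

definition smooth_on :: "'a::euclidean_space set \<Rightarrow> ('a \<Rightarrow> 'b::real_normed_vector) \<Rightarrow> bool" where
  "smooth_on S f \<longleftrightarrow> (\<forall>x\<in>S. \<exists>U F. open U \<and> x \<in> U \<and> (\<forall>n. Ck_on n U F) \<and> (\<forall>y\<in>S \<inter> U. F y = f y))"


definition siegel_jacobi :: "(complex \<times> complex) set" where
  "siegel_jacobi = {(\<tau>, z). Im \<tau> > 0}"

text \<open>Tangent vectors are elements of \<open>\<complex> \<times> \<complex>\<close>; \<open>real_coords\<close> lists their components with respect
  to \<open>(u, v, x, y)\<close>, where \<open>\<tau> = u + \<i>v\<close> and \<open>z = x + \<i>y\<close>.\<close>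

definition real_coords :: "complex \<times> complex \<Rightarrow> real^4" where
  "real_coords X = vector [Re (fst X), Im (fst X), Re (snd X), Im (snd X)]"

definition KB_matrix :: "complex \<times> complex \<Rightarrow> real^4^4" where
  "KB_matrix p = (let v = Im (fst p); y = Im (snd p) in (1/2) *\<^sub>R vector
     [vector [(v + y^2) / v^3, 0, - (y / v^2), 0],
      vector [0, (v + y^2) / v^3, 0, - (y / v^2)],
      vector [- (y / v^2), 0, 1 / v, 0],
      vector [0, - (y / v^2), 0, 1 / v]])"

definition g_KB :: "complex \<times> complex \<Rightarrow> complex \<times> complex \<Rightarrow> complex \<times> complex \<Rightarrow> real" where
  "g_KB p X Y = real_coords X \<bullet> (KB_matrix p *v real_coords Y)"

definition complex_structure :: "complex \<times> complex \<Rightarrow> complex \<times> complex" where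
  "complex_structure X = (\<i> * fst X, \<i> * snd X)"

definition \<omega>_KB :: "complex \<times> complex \<Rightarrow> complex \<times> complex \<Rightarrow> complex \<times> complex \<Rightarrow> real" where
  "\<omega>_KB p X Y = g_KB p (complex_structure X) Y"


type_synonym jacobi_ambient = "(real^2^2) \<times> (real^2) \<times> real"

definition \<Omega> :: "real^2 \<Rightarrow> real^2 \<Rightarrow> real" where
  "\<Omega> \<xi> \<eta> = \<xi>$1 * \<eta>$2 - \<xi>$2 * \<eta>$1"

fun jacobi_mult :: "jacobi_ambient \<Rightarrow> jacobi_ambient \<Rightarrow> jacobi_ambient" where
  "jacobi_mult (M1, X1, \<kappa>1) (M2, X2, \<kappa>2) =
     (M1 ** M2, X1 v* M2 + X2, \<kappa>1 + \<kappa>2 + \<Omega> (X1 v* M2) X2)"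

definition jacobi_group :: "jacobi_ambient monoid" where
  "jacobi_group = \<lparr>carrier = {(M, X, \<kappa>). det M = 1}, mult = jacobi_mult, one = (mat 1, 0, 0)\<rparr>"

lemma \<Omega>_det: "\<Omega> (X v* M) (Y v* M) = det M * \<Omega> X Y"
  by (simp add: \<Omega>_def det_2 vector_matrix_mult_def sum_2 algebra_simps)

lemma \<Omega>_simps [simp]:
  "\<Omega> 0 X = 0" "\<Omega> X 0 = 0" "\<Omega> X X = 0" "\<Omega> (- X) Y = - \<Omega> X Y" "\<Omega> X (- Y) = - \<Omega> X Y"
  "\<Omega> (X + Z) Y = \<Omega> X Y + \<Omega> Z Y" "\<Omega> X (Y + Z) = \<Omega> X Y + \<Omega> X Z"
  "\<Omega> (r *\<^sub>R X) Y = r * \<Omega> X Y" "\<Omega> X (r *\<^sub>R Y) = r * \<Omega> X Y"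
  by (simp_all add: \<Omega>_def algebra_simps)

lemma vector_matrix_minus [simp]: "(- x :: real^'n) v* A = - (x v* A)"
  by (simp add: vector_matrix_mult_def vec_eq_iff sum_negf)

lemma matrix_inv_det_1:
  fixes M :: "real^'n^'n"
  assumes "det M = 1"
  shows "matrix_inv M ** M = mat 1" "M ** matrix_inv M = mat 1" "det (matrix_inv M) = 1"
proof -
  have "invertible M"
    using assms by (simp add: invertible_det_nz)
  then have *: "M ** matrix_inv M = mat 1 \<and> matrix_inv M ** M = mat 1"
    unfolding invertible_def matrix_inv_def by (rule someI_ex)
  then show "matrix_inv M ** M = mat 1" "M ** matrix_inv M = mat 1"
    by auto
  then show "det (matrix_inv M) = 1"
    using assms by (metis det_I det_mul mult.right_neutral)
qed

lemma group_jacobi_group: "group jacobi_group"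
proof (rule groupI)
  fix x y assume "x \<in> carrier jacobi_group" "y \<in> carrier jacobi_group"
  then show "x \<otimes>\<^bsub>jacobi_group\<^esub> y \<in> carrier jacobi_group"
    by (auto simp: jacobi_group_def det_mul)
next
  fix x y z
  assume "x \<in> carrier jacobi_group" "y \<in> carrier jacobi_group" "z \<in> carrier jacobi_group"
  then show "x \<otimes>\<^bsub>jacobi_group\<^esub> y \<otimes>\<^bsub>jacobi_group\<^esub> z =
    x \<otimes>\<^bsub>jacobi_group\<^esub> (y \<otimes>\<^bsub>jacobi_group\<^esub> z)"
    by (auto simp: jacobi_group_def matrix_mul_assoc
        vector_matrix_left_distrib \<Omega>_det simp flip: vector_matrix_mul_assoc)
next
  fix x assume "x \<in> carrier jacobi_group"
  then obtain M X \<kappa> where x: "x = (M, X, \<kappa>)" "det M = 1"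
    by (cases x) (auto simp: jacobi_group_def)
  note M = matrix_inv_det_1[OF x(2)]
  show "\<exists>y\<in>carrier jacobi_group. y \<otimes>\<^bsub>jacobi_group\<^esub> x = \<one>\<^bsub>jacobi_group\<^esub>"
    by (intro bexI[of _ "(matrix_inv M, - (X v* matrix_inv M), - \<kappa>)"])
      (auto simp: jacobi_group_def x M vector_matrix_mul_assoc)
qed (auto simp: jacobi_group_def)

lemma inv_jacobi_group:
  assumes "det M = 1"
  shows "inv\<^bsub>jacobi_group\<^esub> (M, X, \<kappa>) = (matrix_inv M, - (X v* matrix_inv M), - \<kappa>)"
proof -
  interpret group jacobi_group by (rule group_jacobi_group)
  show ?thesis
    using matrix_inv_det_1[OF assms]
    by (intro inv_equality) (auto simp: jacobi_group_def assms vector_matrix_mul_assoc)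
qed


typedef sl2 = "{A :: real^2^2. trace A = 0}"
  by (rule exI[of _ 0]) (simp add: trace_def)

setup_lifting type_definition_sl2

instantiation sl2 :: real_normed_vector
begin

lift_definition zero_sl2 :: sl2 is 0 by (simp add: trace_def)
lift_definition plus_sl2 :: "sl2 \<Rightarrow> sl2 \<Rightarrow> sl2" is "(+)" by (simp add: trace_add)
lift_definition minus_sl2 :: "sl2 \<Rightarrow> sl2 \<Rightarrow> sl2" is "(-)" by (simp add: trace_sub)
lift_definition uminus_sl2 :: "sl2 \<Rightarrow> sl2" is "uminus" by (simp add: trace_def sum_negf)
lift_definition scaleR_sl2 :: "real \<Rightarrow> sl2 \<Rightarrow> sl2" is "(*\<^sub>R)"
  by (simp add: trace_def flip: sum_distrib_left)
lift_definition norm_sl2 :: "sl2 \<Rightarrow> real" is norm .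
lift_definition sgn_sl2 :: "sl2 \<Rightarrow> sl2" is "\<lambda>A. A /\<^sub>R norm A"
  by (simp add: trace_def flip: sum_distrib_left)
definition dist_sl2 :: "sl2 \<Rightarrow> sl2 \<Rightarrow> real" where "dist_sl2 A B = norm (A - B)"
definition uniformity_sl2 :: "(sl2 \<times> sl2) filter" where
  "uniformity_sl2 = (INF e\<in>{0<..}. principal {(A, B). dist A B < e})"
definition open_sl2 :: "sl2 set \<Rightarrow> bool" where
  "open_sl2 U \<longleftrightarrow> (\<forall>A\<in>U. eventually (\<lambda>(A', B). A' = A \<longrightarrow> B \<in> U) uniformity)"

instance
proof
  fix a b :: real and A B C :: sl2 and U :: "sl2 set"
  show "A + B + C = A + (B + C)" by transfer simp
  show "A + B = B + A" by transfer simp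
  show "0 + A = A" by transfer simp
  show "- A + A = 0" by transfer simp
  show "A - B = A + - B" by transfer simp
  show "a *\<^sub>R (A + B) = a *\<^sub>R A + a *\<^sub>R B" by transfer (rule scaleR_add_right)
  show "(a + b) *\<^sub>R A = a *\<^sub>R A + b *\<^sub>R A" by transfer (rule scaleR_add_left)
  show "a *\<^sub>R b *\<^sub>R A = (a * b) *\<^sub>R A" by transfer simp
  show "1 *\<^sub>R A = A" by transfer simp
  show "norm A = 0 \<longleftrightarrow> A = 0" by transfer simp
  show "norm (A + B) \<le> norm A + norm B" by transfer (rule norm_triangle_ineq)
  show "norm (a *\<^sub>R A) = \<bar>a\<bar> * norm A" by transfer simp
  show "sgn A = inverse (norm A) *\<^sub>R A" by transfer simp
  show "dist A B = norm (A - B)" by (rule dist_sl2_def)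
  show "uniformity = (INF e\<in>{0<..}. principal {(A :: sl2, B). dist A B < e})"
    by (rule uniformity_sl2_def)
  show "open U \<longleftrightarrow> (\<forall>A\<in>U. eventually (\<lambda>(A', B). A' = A \<longrightarrow> B \<in> U) uniformity)"
    by (rule open_sl2_def)
qed

end

lift_definition sl2_bracket :: "sl2 \<Rightarrow> sl2 \<Rightarrow> sl2" is "\<lambda>A B. A ** B - B ** A"
  by (simp add: trace_sub) (metis trace_mul_sym)

type_synonym jacobi_algebra = "sl2 \<times> (real^2) \<times> real"

fun jacobi_bracket :: "jacobi_algebra \<Rightarrow> jacobi_algebra \<Rightarrow> jacobi_algebra" where
  "jacobi_bracket (A, \<xi>, r) (B, \<eta>, s) =
     (sl2_bracket A B, \<xi> v* Rep_sl2 B - \<eta> v* Rep_sl2 A, 2 * \<Omega> \<xi> \<eta>)"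

type_synonym jacobi_dual = "jacobi_algebra \<Rightarrow>\<^sub>L real"


fun tangent_incl :: "jacobi_algebra \<Rightarrow> jacobi_ambient" where
  "tangent_incl (A, \<xi>, r) = (Rep_sl2 A, \<xi>, r)"

text \<open>\<open>Ad g\<close> is the differential at the identity of conjugation by \<open>g\<close>.  The formula for conjugation is
  polynomial and so defined on the whole ambient vector space; its derivative there is restricted to
  the tangent space of the group at the identity.\<close>

definition Ad :: "jacobi_ambient \<Rightarrow> jacobi_algebra \<Rightarrow> jacobi_algebra" where
  "Ad g L = inv_into UNIV tangent_incl
     (frechet_derivative (\<lambda>h. g \<otimes>\<^bsub>jacobi_group\<^esub> h \<otimes>\<^bsub>jacobi_group\<^esub> inv\<^bsub>jacobi_group\<^esub> g)
        (at \<one>\<^bsub>jacobi_group\<^esub>) (tangent_incl L))"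

lemma Ad_eq:
  assumes M: "det M = 1"
  shows "tangent_incl (Ad (M, X, \<kappa>) (A, \<xi>, r)) = (M ** Rep_sl2 A ** matrix_inv M,
    (X v* Rep_sl2 A + \<xi>) v* matrix_inv M, r + 2 * \<Omega> X \<xi> - \<Omega> (X v* Rep_sl2 A) X)"
proof -
  let ?M' = "matrix_inv M"
  note M' = matrix_inv_det_1[OF M]
  define C :: "jacobi_ambient \<Rightarrow> jacobi_ambient" where
    "C h = (M ** fst h ** ?M', (X v* fst h + fst (snd h) - X) v* ?M',
       snd (snd h) + \<Omega> (X v* fst h) (fst (snd h)) - \<Omega> (X v* fst h + fst (snd h)) X)" for h
  define D :: "jacobi_ambient \<Rightarrow> jacobi_ambient" where
    "D h = (M ** fst h ** ?M', (X v* fst h + fst (snd h)) v* ?M',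
       snd (snd h) + \<Omega> X (fst (snd h)) - \<Omega> (X v* fst h + fst (snd h)) X)" for h
  have C: "(\<lambda>h. (M, X, \<kappa>) \<otimes>\<^bsub>jacobi_group\<^esub> h \<otimes>\<^bsub>jacobi_group\<^esub> inv\<^bsub>jacobi_group\<^esub> (M, X, \<kappa>)) = C"
    using inv_jacobi_group[OF M, of X \<kappa>]
    by (auto simp: fun_eq_iff C_def jacobi_group_def \<Omega>_det M' vector_matrix_left_distrib
        vector_matrix_mult_diff_distrib)
  have lin1: "bounded_linear (\<lambda>N. M ** N ** ?M')"
    unfolding linear_conv_bounded_linear[symmetric]
    by (intro linearI) (simp_all add: matrix_matrix_mult_def vec_eq_iff sum_2 algebra_simps)
  have lin2: "bounded_linear (\<lambda>N. X v* N)"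
    unfolding linear_conv_bounded_linear[symmetric]
    by (intro linearI) (simp_all add: vector_matrix_mult_def vec_eq_iff sum_2 algebra_simps)
  have lin3: "bounded_linear (\<lambda>Y. Y v* ?M')"
    unfolding linear_conv_bounded_linear[symmetric]
    by (intro linearI) (simp_all add: vector_matrix_mult_def vec_eq_iff sum_2 algebra_simps)
  have bil: "bounded_bilinear \<Omega>"
    unfolding bilinear_conv_bounded_bilinear[symmetric] bilinear_def
    by (auto intro!: linearI)
  have lin4: "bounded_linear (\<lambda>Y. \<Omega> Y X)"
    using bil by (rule bounded_bilinear.bounded_linear_left)
  note bounded_linear.has_derivative[OF lin1, derivative_intros]
    bounded_linear.has_derivative[OF lin2, derivative_intros]
    bounded_linear.has_derivative[OF lin3, derivative_intros]
    bounded_linear.has_derivative[OF lin4, derivative_intros]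
    bounded_bilinear.FDERIV[OF bil, derivative_intros]
  have "(C has_derivative D) (at \<one>\<^bsub>jacobi_group\<^esub>)"
    unfolding C_def
    by (auto intro!: derivative_eq_intros simp: D_def jacobi_group_def)
  then have D: "frechet_derivative C (at \<one>\<^bsub>jacobi_group\<^esub>) = D"
    by (metis frechet_derivative_at)
  have inj: "inj tangent_incl"
    by (auto simp: inj_on_def Rep_sl2_inject)
  have "trace (M ** Rep_sl2 A ** ?M') = trace (?M' ** M ** Rep_sl2 A)"
    by (metis matrix_mul_assoc trace_mul_sym)
  then have tr: "trace (M ** Rep_sl2 A ** ?M') = 0"
    using Rep_sl2[of A] by (simp add: M')
  have "D (tangent_incl (A, \<xi>, r)) = tangent_incl (Abs_sl2 (M ** Rep_sl2 A ** ?M'),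
      (X v* Rep_sl2 A + \<xi>) v* ?M', r + 2 * \<Omega> X \<xi> - \<Omega> (X v* Rep_sl2 A) X)" (is "_ = tangent_incl ?R")
    using tr by (simp add: D_def Abs_sl2_inverse) (simp add: \<Omega>_def algebra_simps)
  then have "Ad (M, X, \<kappa>) (A, \<xi>, r) = ?R"
    unfolding Ad_def C D by (simp only: inv_into_f_f[OF inj UNIV_I])
  then show ?thesis
    using tr by (simp add: Abs_sl2_inverse)
qed

lemma bounded_linear_tangent_incl: "bounded_linear tangent_incl"
proof (rule bounded_linear_intro[where K = 1])
  fix L K :: jacobi_algebra and c :: real
  show "tangent_incl (L + K) = tangent_incl L + tangent_incl K"
    by (cases L; cases K) (simp add: plus_sl2.rep_eq)
  show "tangent_incl (c *\<^sub>R L) = c *\<^sub>R tangent_incl L"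
    by (cases L) (simp add: scaleR_sl2.rep_eq)
  show "norm (tangent_incl L) \<le> norm L * 1"
    by (cases L) (simp add: norm_Pair norm_sl2.rep_eq)
qed

lemma bounded_linear_jacobi_algebra:
  assumes "linear T" and T: "\<And>L. tangent_incl (f L) = T (tangent_incl L)"
  shows "bounded_linear f"
proof -
  have "bounded_linear T"
    using assms(1) by (simp add: linear_conv_bounded_linear)
  then have "bounded_linear (\<lambda>L. T (tangent_incl L))"
    using bounded_linear_tangent_incl by (rule bounded_linear_compose)
  then interpret bounded_linear "\<lambda>L. tangent_incl (f L)"
    by (simp add: T)
  interpret ti: bounded_linear tangent_incl
    by (rule bounded_linear_tangent_incl)
  have inj: "tangent_incl L = tangent_incl K \<longleftrightarrow> L = K" for L K
    by (cases L; cases K) (simp add: Rep_sl2_inject)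
  have norm: "norm (tangent_incl L) = norm L" for L
    by (cases L) (simp add: norm_Pair norm_sl2.rep_eq)
  obtain K where "\<And>L. norm (tangent_incl (f L)) \<le> norm L * K"
    using bounded by blast
  then show ?thesis
    by (intro bounded_linear_intro[where K = K])
      (simp_all only: norm add scale ti.add ti.scale flip: inj)
qed

lemma bounded_linear_Ad:
  assumes "g \<in> carrier jacobi_group"
  shows "bounded_linear (Ad g)"
proof -
  obtain M X \<kappa> where g: "g = (M, X, \<kappa>)" "det M = 1"
    using assms by (cases g) (auto simp: jacobi_group_def)
  show ?thesis
  proof (rule bounded_linear_jacobi_algebra)
    show "tangent_incl (Ad g L) = (\<lambda>(A, \<xi>, r). (M ** A ** matrix_inv M,
      (X v* A + \<xi>) v* matrix_inv M, r + 2 * \<Omega> X \<xi> - \<Omega> (X v* A) X)) (tangent_incl L)" for L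
      by (cases L) (simp only: g(1) Ad_eq[OF g(2)] tangent_incl.simps prod.case)
    show "linear (\<lambda>(A :: real^2^2, \<xi>, r). (M ** A ** matrix_inv M,
      (X v* A + \<xi>) v* matrix_inv M, r + 2 * \<Omega> X \<xi> - \<Omega> (X v* A) X))"
      by (intro linearI)
        (auto simp: vector_matrix_mult_def matrix_matrix_mult_def vec_eq_iff sum_2 \<Omega>_def algebra_simps)
  qed
qed

lemma bounded_linear_jacobi_bracket: "bounded_linear (jacobi_bracket L)"
proof -
  obtain A \<xi> r where L: "L = (A, \<xi>, r)"
    by (cases L)
  let ?A = "Rep_sl2 A"
  show ?thesis
  proof (rule bounded_linear_jacobi_algebra)
    show "tangent_incl (jacobi_bracket L K) =
      (\<lambda>(B, \<eta>, s). (?A ** B - B ** ?A, \<xi> v* B - \<eta> v* ?A, 2 * \<Omega> \<xi> \<eta>)) (tangent_incl K)" for K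
      by (cases K) (simp add: L sl2_bracket.rep_eq)
    show "linear (\<lambda>(B, \<eta>, s :: real). (?A ** B - B ** ?A, \<xi> v* B - \<eta> v* ?A, 2 * \<Omega> \<xi> \<eta>))"
      by (intro linearI)
        (auto simp: vector_matrix_mult_def matrix_matrix_mult_def vec_eq_iff sum_2 \<Omega>_def algebra_simps)
  qed
qed

lemma jacobi_bracket_anticomm: "jacobi_bracket L K = - jacobi_bracket K L"
proof (cases L; cases K)
  fix A B :: sl2 and \<xi> \<eta> :: "real^2" and r s :: real
  assume "L = (A, \<xi>, r)" "K = (B, \<eta>, s)"
  moreover have "sl2_bracket A B = - sl2_bracket B A"
    by transfer simp
  ultimately show ?thesis
    by (simp add: \<Omega>_def)
qed

definition coAd :: "jacobi_ambient \<Rightarrow> jacobi_dual \<Rightarrow> jacobi_dual" where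
  "coAd g \<alpha> = Blinfun (\<lambda>L. blinfun_apply \<alpha> (Ad (inv\<^bsub>jacobi_group\<^esub> g) L))"

lemma coAd_apply:
  assumes "g \<in> carrier jacobi_group"
  shows "blinfun_apply (coAd g \<alpha>) L = blinfun_apply \<alpha> (Ad (inv\<^bsub>jacobi_group\<^esub> g) L)"
proof -
  interpret group jacobi_group by (rule group_jacobi_group)
  have "bounded_linear (Ad (inv\<^bsub>jacobi_group\<^esub> g))"
    using assms by (intro bounded_linear_Ad inv_closed)
  then show ?thesis
    by (simp add: coAd_def bounded_linear_Blinfun_apply blinfun.bounded_linear_right bounded_linear_compose)
qed

definition coad :: "jacobi_algebra \<Rightarrow> jacobi_dual \<Rightarrow> jacobi_dual" where
  "coad \<xi> \<alpha> = Blinfun (\<lambda>\<eta>. blinfun_apply \<alpha> (jacobi_bracket \<xi> \<eta>))"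

lemma coad_apply: "blinfun_apply (coad \<xi> \<alpha>) \<eta> = blinfun_apply \<alpha> (jacobi_bracket \<xi> \<eta>)"
  by (simp add: coad_def bounded_linear_Blinfun_apply blinfun.bounded_linear_right
      bounded_linear_compose[OF _ bounded_linear_jacobi_bracket])

definition coadjoint_orbit :: "jacobi_dual \<Rightarrow> jacobi_dual set" where
  "coadjoint_orbit \<mu> = {coAd g \<mu> | g. g \<in> carrier jacobi_group}"

definition orbit_tangent :: "jacobi_dual \<Rightarrow> jacobi_dual set" where
  "orbit_tangent \<alpha> = range (\<lambda>\<xi>. coad \<xi> \<alpha>)"

definition KKS_form :: "jacobi_dual \<Rightarrow> jacobi_dual \<Rightarrow> jacobi_dual \<Rightarrow> real" where
  "KKS_form \<alpha> a b = (THE c. \<exists>\<xi> \<eta>. a = coad \<xi> \<alpha> \<and> b = coad \<eta> \<alpha> \<and>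
     c = blinfun_apply \<alpha> (jacobi_bracket \<xi> \<eta>))"

lemma KKS_form_coad:
  "KKS_form \<alpha> (coad \<xi> \<alpha>) (coad \<eta> \<alpha>) = blinfun_apply \<alpha> (jacobi_bracket \<xi> \<eta>)"
  unfolding KKS_form_def
proof (rule the_equality)
  fix c
  assume "\<exists>\<xi>' \<eta>'. coad \<xi> \<alpha> = coad \<xi>' \<alpha> \<and> coad \<eta> \<alpha> = coad \<eta>' \<alpha> \<and>
    c = blinfun_apply \<alpha> (jacobi_bracket \<xi>' \<eta>')"
  then obtain \<xi>' \<eta>' where *: "coad \<xi> \<alpha> = coad \<xi>' \<alpha>" "coad \<eta> \<alpha> = coad \<eta>' \<alpha>"
    and c: "c = blinfun_apply \<alpha> (jacobi_bracket \<xi>' \<eta>')"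
    by blast
  have "c = blinfun_apply (coad \<xi> \<alpha>) \<eta>'"
    using * c by (simp add: coad_apply)
  also have "\<dots> = - blinfun_apply (coad \<eta>' \<alpha>) \<xi>"
    by (simp add: coad_apply jacobi_bracket_anticomm[of \<xi> \<eta>'] blinfun.minus_right)
  also have "\<dots> = - blinfun_apply (coad \<eta> \<alpha>) \<xi>"
    using * by simp
  also have "\<dots> = blinfun_apply \<alpha> (jacobi_bracket \<xi> \<eta>)"
    by (simp add: coad_apply jacobi_bracket_anticomm[of \<eta> \<xi>] blinfun.minus_right)
  finally show "c = blinfun_apply \<alpha> (jacobi_bracket \<xi> \<eta>)" .
qed blast

text \<open>The immersed submanifold structure of the orbit of \<open>\<mu>\<close> is that of the homogeneous space
  \<open>G/G\<^sub>\<mu>\<close>: it makes the orbit map \<open>g \<mapsto> coAd g \<mu>\<close> a smooth surjective submersion.  Hence maps into the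
  orbit are smooth iff they lift locally to smooth maps into the group, and maps out of the orbit are
  smooth iff their composition with the orbit map is.\<close>

definition smooth_into_orbit ::
  "jacobi_dual \<Rightarrow> 'a::euclidean_space set \<Rightarrow> ('a \<Rightarrow> jacobi_dual) \<Rightarrow> bool" where
  "smooth_into_orbit \<mu> S f \<longleftrightarrow> (\<forall>p\<in>S. \<exists>U \<sigma>. open U \<and> p \<in> U \<and> smooth_on (S \<inter> U) \<sigma> \<and>
     (\<forall>q\<in>S \<inter> U. \<sigma> q \<in> carrier jacobi_group \<and> f q = coAd (\<sigma> q) \<mu>))"

definition smooth_from_orbit ::
  "jacobi_dual \<Rightarrow> (jacobi_dual \<Rightarrow> 'a::euclidean_space) \<Rightarrow> bool" where
  "smooth_from_orbit \<mu> h \<longleftrightarrow> smooth_on (carrier jacobi_group) (\<lambda>g. h (coAd g \<mu>))"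

definition diffeomorphism_onto_orbit ::
  "jacobi_dual \<Rightarrow> 'a::euclidean_space set \<Rightarrow> ('a \<Rightarrow> jacobi_dual) \<Rightarrow> bool" where
  "diffeomorphism_onto_orbit \<mu> S f \<longleftrightarrow> bij_betw f S (coadjoint_orbit \<mu>) \<and>
     smooth_into_orbit \<mu> S f \<and> smooth_from_orbit \<mu> (inv_into S f)"

definition pullback ::
  "('a::real_normed_vector \<Rightarrow> 'b::real_normed_vector) \<Rightarrow> ('b \<Rightarrow> 'b \<Rightarrow> 'b \<Rightarrow> real) \<Rightarrow> 'a \<Rightarrow> 'a \<Rightarrow> 'a \<Rightarrow> real" where
  "pullback f \<omega> p X Y =
     \<omega> (f p) (frechet_derivative f (at p) X) (frechet_derivative f (at p) Y)"


context
  fixes p :: "complex \<times> complex"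
begin

definition \<theta>1 :: real where "\<theta>1 = Im (snd p)"
definition \<theta>2 :: real where "\<theta>2 = - Im (fst p)"
definition \<theta>dot1 :: real where "\<theta>dot1 = - Re (snd p)"
definition \<theta>dot2 :: real where "\<theta>dot2 = Re (fst p)"
definition \<eta>1 :: real where "\<eta>1 = - \<theta>1 / (2 * \<theta>2)"
definition \<eta>2 :: real where "\<eta>2 = (\<theta>1^2 - 2 * \<theta>2) / (4 * \<theta>2^2)"

definition JF :: real where "JF = - \<eta>2"
definition JG :: real where
  "JG = \<theta>dot1^2 / 4 + \<eta>2 * \<theta>dot2^2 + \<eta>1 * \<theta>dot1 * \<theta>dot2 - 1 / (4 * (\<eta>1^2 - \<eta>2))"
definition JH :: real where "JH = - \<eta>1 * \<theta>dot1 - 2 * \<eta>2 * \<theta>dot2"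
definition JP :: real where "JP = \<theta>dot1 / 2 + \<eta>1 * \<theta>dot2"
definition JQ :: real where "JQ = \<eta>1"
definition JR :: real where "JR = - 1 / 4"

text \<open>The coordinates of \<open>A \<in> sl(2,\<real>)\<close> with respect to \<open>F\<close>, \<open>G\<close>, \<open>H\<close> are its entries
  \<open>A$1$2\<close>, \<open>A$2$1\<close>, \<open>A$1$1\<close>.\<close>

definition momentum_map :: jacobi_dual where
  "momentum_map = Blinfun (\<lambda>(A, \<xi>, r).
     Rep_sl2 A $ 1 $ 2 * JF + Rep_sl2 A $ 2 $ 1 * JG + Rep_sl2 A $ 1 $ 1 * JH
       + \<xi> $ 1 * JP + \<xi> $ 2 * JQ + r * JR)"

end

lemma momentum_map_apply:
  "blinfun_apply (momentum_map p) (A, \<xi>, r) =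
     Rep_sl2 A $ 1 $ 2 * JF p + Rep_sl2 A $ 2 $ 1 * JG p + Rep_sl2 A $ 1 $ 1 * JH p
       + \<xi> $ 1 * JP p + \<xi> $ 2 * JQ p + r * JR"
proof -
  let ?T = "\<lambda>(A :: real^2^2, \<xi> :: real^2, r). A $ 1 $ 2 * JF p + A $ 2 $ 1 * JG p
    + A $ 1 $ 1 * JH p + \<xi> $ 1 * JP p + \<xi> $ 2 * JQ p + r * JR"
  have "bounded_linear ?T"
    unfolding linear_conv_bounded_linear[symmetric]
    by (intro linearI) (auto simp: algebra_simps)
  then have "bounded_linear (\<lambda>L. ?T (tangent_incl L))"
    using bounded_linear_tangent_incl by (rule bounded_linear_compose)
  moreover have "(\<lambda>L. ?T (tangent_incl L)) = (\<lambda>(A, \<xi>, r).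
      Rep_sl2 A $ 1 $ 2 * JF p + Rep_sl2 A $ 2 $ 1 * JG p + Rep_sl2 A $ 1 $ 1 * JH p
       + \<xi> $ 1 * JP p + \<xi> $ 2 * JQ p + r * JR)"
    by auto
  ultimately show ?thesis
    by (simp add: momentum_map_def bounded_linear_Blinfun_apply)
qed

end

theory Submission
  imports Defs
begin

text \<open>The group acts transitively: an upper triangular matrix with diagonal \<open>\<surd>v, 1/\<surd>v\<close> together
  with a translation carries \<open>(\<i>, 0)\<close> to any given \<open>p\<close>, smoothly in \<open>p\<close>.  In terms of \<open>P = JP p\<close> and
  \<open>Q = JQ p\<close> the momentum map is \<open>JF = - Q\<^sup>2 - 1 / (2 v)\<close>, \<open>JH = - 2 P Q - u / v\<close>,
  \<open>JG = P\<^sup>2 + (u\<^sup>2 + v\<^sup>2) / (2 v)\<close>; so \<open>p\<close> can be read off from \<open>JF, JH, P, Q\<close>, and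
  \<open>J (g \<cdot> (\<i>, 0)) = coAd g (J (\<i>, 0))\<close> is a polynomial identity modulo \<open>det = 1\<close>.  Hence \<open>J\<close> is a
  bijection onto the orbit of \<open>J (\<i>, 0)\<close>, whose inverse lifts to the rational map
  \<open>g \<mapsto> g \<cdot> (\<i>, 0)\<close>.  The derivative of \<open>J\<close> maps the infinitesimal action of \<open>L\<close> to \<open>coad L (J p)\<close>;
  since every tangent vector comes from some \<open>L\<close> with upper triangular matrix part, the
  Kirillov-Kostant-Souriau form can be compared with \<open>\<omega>_KB\<close> on such \<open>L\<close>.\<close>

subsection \<open>Closure properties of \<open>C\<^sup>n\<close> maps\<close>

text \<open>On an open set the Frechet derivative depends only on local values, so the induction can
  pass from \<open>f\<close> and \<open>g\<close> to their directional derivatives.\<close>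

lemma Ck_on_cong:
  assumes "open U" "\<And>x. x \<in> U \<Longrightarrow> f x = g x" "Ck_on n U f"
  shows "Ck_on n U g"
  using assms(2,3)
proof (induction n arbitrary: f g)
  case 0
  then show ?case by (simp cong: continuous_on_cong)
next
  case (Suc n)
  have D: "(g has_derivative frechet_derivative f (at x)) (at x)" if "x \<in> U" for x
  proof -
    have "(f has_derivative frechet_derivative f (at x)) (at x)"
      using Suc.prems(2) that by (simp flip: frechet_derivative_works)
    then show ?thesis
      using assms(1) that Suc.prems(1) by (rule has_derivative_transform_within_open)
  qed
  have "Ck_on n U (\<lambda>x. frechet_derivative g (at x) v)" for v
    by (rule Suc.IH[of "\<lambda>x. frechet_derivative f (at x) v"])
      (use Suc.prems(2) frechet_derivative_at[OF D] in auto)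
  then show ?case
    using D by (auto simp: differentiable_def)
qed

text \<open>Lets an explicit derivative formula, known only on \<open>U\<close>, stand in for the
  chosen \<open>frechet_derivative\<close>.\<close>

lemma Ck_on_SucI:
  assumes "open U" and D: "\<And>x. x \<in> U \<Longrightarrow> (f has_derivative f' x) (at x)"
    and C: "\<And>v. Ck_on n U (\<lambda>x. f' x v)"
  shows "Ck_on (Suc n) U f"
proof -
  have "Ck_on n U (\<lambda>x. frechet_derivative f (at x) v)" for v
    using frechet_derivative_at[OF D]
    by (intro Ck_on_cong[OF assms(1) _ C[of v]]) auto
  then show ?thesis
    using D by (auto simp: differentiable_def)
qed

lemma Ck_on_SucD:
  assumes "Ck_on (Suc n) U f"
  shows "x \<in> U \<Longrightarrow> (f has_derivative frechet_derivative f (at x)) (at x)"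
    and "Ck_on n U (\<lambda>x. frechet_derivative f (at x) v)"
  using assms by (simp_all flip: frechet_derivative_works)

lemma Ck_on_Suc_imp: "Ck_on (Suc n) U f \<Longrightarrow> Ck_on n U f"
proof (induction n arbitrary: f)
  case 0
  then show ?case
    by (auto intro!: differentiable_imp_continuous_on differentiable_at_imp_differentiable_on)
next
  case (Suc n)
  then show ?case
    unfolding Ck_on.simps(2)[of "Suc n"] Ck_on.simps(2)[of n U f] by blast
qed

lemma Ck_on_const: "open U \<Longrightarrow> Ck_on n U (\<lambda>_. c)"
proof (induction n arbitrary: c)
  case (Suc n)
  then show ?case
    by (intro Ck_on_SucI[where f' = "\<lambda>_ _. 0"]) auto
qed simp

lemma Ck_on_bounded_linear:
  assumes "open U" "bounded_linear f"
  shows "Ck_on n U f"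
proof (cases n)
  case 0
  then show ?thesis
    using assms by (simp add: linear_continuous_on)
next
  case (Suc m)
  then show ?thesis
    using assms
    by (auto intro!: Ck_on_SucI[where f' = "\<lambda>_. f"] Ck_on_const bounded_linear_imp_has_derivative
        simp del: Ck_on.simps)
qed

lemma Ck_on_add:
  assumes "open U"
  shows "Ck_on n U f \<Longrightarrow> Ck_on n U g \<Longrightarrow> Ck_on n U (\<lambda>x. f x + g x)"
proof (induction n arbitrary: f g)
  case 0
  then show ?case by (simp add: continuous_on_add)
next
  case (Suc n)
  note f = Ck_on_SucD[OF Suc.prems(1)] and g = Ck_on_SucD[OF Suc.prems(2)]
  show ?case
    by (rule Ck_on_SucI[OF assms has_derivative_add[OF f(1) g(1)] Suc.IH[OF f(2) g(2)]])
qed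

lemma Ck_on_linear_image:
  assumes "open U" "bounded_linear L"
  shows "Ck_on n U f \<Longrightarrow> Ck_on n U (\<lambda>x. L (f x))"
proof (induction n arbitrary: f)
  case 0
  then show ?case
    by (simp add: bounded_linear.continuous_on[OF assms(2)])
next
  case (Suc n)
  note f = Ck_on_SucD[OF Suc.prems]
  show ?case
    by (rule Ck_on_SucI[OF assms(1) bounded_linear.has_derivative[OF assms(2) f(1)] Suc.IH[OF f(2)]])
qed

text \<open>By the product rule each summand of the derivative contains one undifferentiated factor,
  whose order is lowered by \<open>Ck_on_Suc_imp\<close> before the induction hypothesis
  applies.\<close>

lemma Ck_on_bilinear:
  assumes "open U" "bounded_bilinear bop"
  shows "Ck_on n U f \<Longrightarrow> Ck_on n U g \<Longrightarrow> Ck_on n U (\<lambda>x. bop (f x) (g x))"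
proof (induction n arbitrary: f g)
  case 0
  then show ?case by (simp add: bounded_bilinear.continuous_on[OF assms(2)])
next
  case (Suc n)
  note f = Ck_on_SucD[OF Suc.prems(1)] and g = Ck_on_SucD[OF Suc.prems(2)]
  show ?case
    by (rule Ck_on_SucI[OF assms(1) bounded_bilinear.FDERIV[OF assms(2) f(1) g(1)]
          Ck_on_add[OF assms(1) Suc.IH[OF Ck_on_Suc_imp[OF Suc.prems(1)] g(2)]
            Suc.IH[OF f(2) Ck_on_Suc_imp[OF Suc.prems(2)]]]])
qed

lemmas Ck_on_mult = Ck_on_bilinear[OF _ bounded_bilinear_mult]
lemmas Ck_on_scaleR = Ck_on_bilinear[OF _ bounded_bilinear_scaleR]


text \<open>The derivative contains \<open>inverse (f x)\<close> itself, but only to order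
  \<open>n\<close>; hence an induction on \<open>n\<close> with \<open>f\<close> fixed.\<close>

lemma Ck_on_inverse:
  fixes f :: "'a::euclidean_space \<Rightarrow> 'b::real_normed_field"
  assumes "open U" "\<And>x. x \<in> U \<Longrightarrow> f x \<noteq> 0"
  shows "Ck_on n U f \<Longrightarrow> Ck_on n U (\<lambda>x. inverse (f x))"
proof (induction n)
  case 0
  then show ?case
    using assms(2) by (auto intro!: continuous_on_inverse)
next
  case (Suc n)
  note f = Ck_on_SucD[OF Suc.prems]
  have IH: "Ck_on n U (\<lambda>x. inverse (f x))"
    by (rule Suc.IH[OF Ck_on_Suc_imp[OF Suc.prems]])
  have C: "Ck_on n U (\<lambda>x. (-1) * (inverse (f x) * frechet_derivative f (at x) v * inverse (f x)))" for v
    by (intro Ck_on_mult Ck_on_const IH f assms(1))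
  show ?case
    by (rule Ck_on_SucI[OF assms(1) _ C])
      (use Deriv.has_derivative_inverse[OF assms(2) f(1)] in simp)
qed

lemma Ck_on_divide:
  fixes f g :: "'a::euclidean_space \<Rightarrow> 'b::real_normed_field"
  assumes "open U" "Ck_on n U f" "Ck_on n U g" "\<And>x. x \<in> U \<Longrightarrow> g x \<noteq> 0"
  shows "Ck_on n U (\<lambda>x. f x / g x)"
  unfolding divide_inverse using assms by (intro Ck_on_mult Ck_on_inverse)

lemma Ck_on_sqrt:
  assumes "open U" "\<And>x. x \<in> U \<Longrightarrow> f x > 0"
  shows "Ck_on n U f \<Longrightarrow> Ck_on n U (\<lambda>x. sqrt (f x))"
proof (induction n)
  case 0
  then show ?case
    by (auto intro!: continuous_intros)
next
  case (Suc n)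
  note f = Ck_on_SucD[OF Suc.prems]
  have IH: "Ck_on n U (\<lambda>x. sqrt (f x))"
    by (rule Suc.IH[OF Ck_on_Suc_imp[OF Suc.prems]])
  have nz: "sqrt (f x) \<noteq> 0" if "x \<in> U" for x
    using assms(2)[OF that] by simp
  have C: "Ck_on n U (\<lambda>x. (1/2) * inverse (sqrt (f x)) * frechet_derivative f (at x) v)" for v
    using nz by (intro Ck_on_mult Ck_on_const Ck_on_inverse IH f assms(1)) auto
  show ?case
    by (rule Ck_on_SucI[OF assms(1) _ C])
      (use DERIV_compose_FDERIV[OF DERIV_real_sqrt[OF assms(2)] f(1)] in \<open>simp add: field_simps\<close>)
qed

text \<open>The pair is the sum of \<open>(f x, 0)\<close> and \<open>(0, g x)\<close>, two bounded
  linear images.\<close>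

lemma Ck_on_Pair:
  assumes "open U" "Ck_on n U f" "Ck_on n U g"
  shows "Ck_on n U (\<lambda>x. (f x, g x))"
proof -
  note ident = bounded_linear_ident and zero = bounded_linear_zero
  show ?thesis
    using Ck_on_add[OF assms(1)
        Ck_on_linear_image[OF assms(1) bounded_linear_Pair[OF ident zero] assms(2)]
        Ck_on_linear_image[OF assms(1) bounded_linear_Pair[OF zero ident] assms(3)]]
    by simp
qed

lemma smooth_on_openI:
  assumes "open S" "\<And>n. Ck_on n S f"
  shows "smooth_on S f"
  using assms unfolding smooth_on_def by blast

subsection \<open>The momentum map in coordinates\<close>

text \<open>The arguments are the values on the basis F, G, H, P, Q, R. Passing through
  \<open>tangent_incl\<close> reduces boundedness to linearity on a Euclidean space.\<close>

definition covector :: "real \<Rightarrow> real \<Rightarrow> real \<Rightarrow> real \<Rightarrow> real \<Rightarrow> real \<Rightarrow> jacobi_dual" where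
  "covector a b c d e r = Blinfun (\<lambda>L. case tangent_incl L of (A, \<xi>, s) \<Rightarrow>
     A $ 1 $ 2 * a + A $ 2 $ 1 * b + A $ 1 $ 1 * c + \<xi> $ 1 * d + \<xi> $ 2 * e + s * r)"

lemma covector_apply:
  "blinfun_apply (covector a b c d e r) L = (case tangent_incl L of (A, \<xi>, s) \<Rightarrow>
     A $ 1 $ 2 * a + A $ 2 $ 1 * b + A $ 1 $ 1 * c + \<xi> $ 1 * d + \<xi> $ 2 * e + s * r)"
proof -
  have "bounded_linear (\<lambda>(A :: real^2^2, \<xi> :: real^2, s).
      A $ 1 $ 2 * a + A $ 2 $ 1 * b + A $ 1 $ 1 * c + \<xi> $ 1 * d + \<xi> $ 2 * e + s * r)"
    unfolding linear_conv_bounded_linear[symmetric]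
    by (intro linearI) (auto simp: algebra_simps)
  from bounded_linear_compose[OF this bounded_linear_tangent_incl] show ?thesis
    by (simp add: covector_def bounded_linear_Blinfun_apply)
qed

lemma covector_apply_components:
  "blinfun_apply (covector a b c d e r) (A, \<xi>, s) =
     Rep_sl2 A $ 1 $ 2 * a + Rep_sl2 A $ 2 $ 1 * b + Rep_sl2 A $ 1 $ 1 * c
       + \<xi> $ 1 * d + \<xi> $ 2 * e + s * r"
  by (simp add: covector_apply)

text \<open>Separating scalar coefficients from fixed covectors reduces differentiation of
  covector-valued maps to that of real functions.\<close>

lemma covector_expand:
  "covector a b c d e r = a *\<^sub>R covector 1 0 0 0 0 0 + b *\<^sub>R covector 0 1 0 0 0 0
    + c *\<^sub>R covector 0 0 1 0 0 0 + d *\<^sub>R covector 0 0 0 1 0 0 + e *\<^sub>R covector 0 0 0 0 1 0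
    + r *\<^sub>R covector 0 0 0 0 0 1"
  by (rule blinfun_eqI) (auto simp: covector_apply_components blinfun.add_left blinfun.scaleR_left)

lemma momentum_map_covector:
  "momentum_map p = covector (JF p) (JG p) (JH p) (JP p) (JQ p) JR"
  by (rule blinfun_eqI) (auto simp: covector_apply_components momentum_map_apply)

lemma Rep_sl2_diag: "Rep_sl2 A $ 2 $ 2 = - Rep_sl2 A $ 1 $ 1"
  using Rep_sl2[of A] by (simp add: trace_def sum_2)

definition sl2_of :: "real \<Rightarrow> real \<Rightarrow> real \<Rightarrow> sl2" where
  "sl2_of \<alpha> \<beta> \<gamma> = Abs_sl2 (vector [vector [\<alpha>, \<beta>], vector [\<gamma>, - \<alpha>]])"

lemma Rep_sl2_of [simp]: "Rep_sl2 (sl2_of \<alpha> \<beta> \<gamma>) = vector [vector [\<alpha>, \<beta>], vector [\<gamma>, - \<alpha>]]"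
  unfolding sl2_of_def by (rule Abs_sl2_inverse) (simp add: trace_def sum_2)

lemma covector_inject:
  assumes "covector a b c d e r = covector a' b' c' d' e' r'"
  shows "a = a' \<and> b = b' \<and> c = c' \<and> d = d' \<and> e = e' \<and> r = r'"
proof -
  have eq: "blinfun_apply (covector a b c d e r) L = blinfun_apply (covector a' b' c' d' e' r') L" for L
    by (simp add: assms)
  show ?thesis
    \<comment> \<open>The test vectors are F, G, H, P, Q, R in this order.\<close>
    using eq[of "(sl2_of 0 1 0, 0, 0)"] eq[of "(sl2_of 0 0 1, 0, 0)"] eq[of "(sl2_of 1 0 0, 0, 0)"]
      eq[of "(sl2_of 0 0 0, vector [1, 0], 0)"] eq[of "(sl2_of 0 0 0, vector [0, 1], 0)"]
      eq[of "(sl2_of 0 0 0, 0, 1)"]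
    by (simp add: covector_apply)
qed

text \<open>The structure constants of the Lie algebra, with the lower right matrix entry eliminated
  by trace zero. The last coefficient vanishes because R is central.\<close>

lemma coad_covector:
  "coad (A, \<xi>, s) (covector a b c d e r) =
    (let \<alpha> = Rep_sl2 A $ 1 $ 1; \<beta> = Rep_sl2 A $ 1 $ 2; \<gamma> = Rep_sl2 A $ 2 $ 1 in
      covector (2 * \<alpha> * a - \<gamma> * c + \<xi> $ 1 * e)
        (- 2 * \<alpha> * b + \<beta> * c + \<xi> $ 2 * d)
        (- 2 * \<beta> * a + 2 * \<gamma> * b + \<xi> $ 1 * d - \<xi> $ 2 * e)
        (- \<alpha> * d - \<beta> * e - 2 * \<xi> $ 2 * r)
        (- \<gamma> * d + \<alpha> * e + 2 * \<xi> $ 1 * r) 0)"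
  unfolding Let_def
  by (rule blinfun_eqI)
    (auto simp: coad_apply covector_apply_components sl2_bracket.rep_eq Rep_sl2_diag \<Omega>_def
      vector_matrix_mult_def matrix_matrix_mult_def sum_2 algebra_simps)

lemma JQ_eq: "JQ p = Im (snd p) / (2 * Im (fst p))"
  by (simp add: JQ_def \<eta>1_def \<theta>1_def \<theta>2_def)

lemma JP_eq: "JP p = Re (fst p) * JQ p - Re (snd p) / 2"
  by (simp add: JP_def JQ_def \<theta>dot1_def \<theta>dot2_def)

lemma \<eta>2_eq: "\<eta>2 p = (JQ p)\<^sup>2 + 1 / (2 * Im (fst p))"
  \<comment> \<open>If \<open>Im (fst p) = 0\<close>, all quotients are 0 by the convention for
    division by zero.\<close>
  by (cases "Im (fst p) = 0")
    (simp_all add: JQ_eq \<eta>2_def \<theta>1_def \<theta>2_def field_simps power2_eq_square)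

lemma JF_eq: "JF p = - (JQ p)\<^sup>2 - 1 / (2 * Im (fst p))"
  by (simp add: JF_def \<eta>2_eq)

text \<open>Here \<open>\<eta>1^2 - \<eta>2\<close> is \<open>- 1 / (2 v)\<close>, which turns the
  last term of \<open>JG\<close> into \<open>v / 2\<close>; the terms quadratic in \<open>x\<close>
  and \<open>u Q\<close> complete the square of \<open>JP\<close>.\<close>

lemma JG_eq: "JG p = (JP p)\<^sup>2 + ((Re (fst p))\<^sup>2 + (Im (fst p))\<^sup>2) / (2 * Im (fst p))"
proof -
  have "JG p = (Re (snd p))\<^sup>2 / 4 + ((JQ p)\<^sup>2 + 1 / (2 * Im (fst p))) * (Re (fst p))\<^sup>2
      - JQ p * Re (snd p) * Re (fst p) + Im (fst p) / 2"
    by (simp add: JG_def \<eta>2_eq JQ_def[symmetric] \<theta>dot1_def \<theta>dot2_def)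
  then show ?thesis
    by (cases "Im (fst p) = 0") (simp_all add: JP_eq field_simps power2_eq_square)
qed

lemma JH_eq: "JH p = - 2 * JP p * JQ p - Re (fst p) / Im (fst p)"
  by (simp add: JH_def \<eta>2_eq JQ_def[symmetric] JP_eq \<theta>dot1_def \<theta>dot2_def
      field_simps power2_eq_square)

subsection \<open>The orbit of the base point\<close>

text \<open>The point \<open>g \<cdot> (\<i>, 0)\<close>, and a smooth choice of a group element carrying \<open>(\<i>, 0)\<close> to \<open>p\<close>.\<close>

definition base_orbit :: "jacobi_ambient \<Rightarrow> complex \<times> complex" where
  "base_orbit g = (case g of (M, X, \<kappa>) \<Rightarrow>
     let j = of_real (M $ 2 $ 1) * \<i> + of_real (M $ 2 $ 2) in
       ((of_real (M $ 1 $ 1) * \<i> + of_real (M $ 1 $ 2)) / j,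
        (of_real (X $ 1) * \<i> + of_real (X $ 2)) / j))"

definition orbit_section :: "complex \<times> complex \<Rightarrow> jacobi_ambient" where
  "orbit_section p = (let s = sqrt (Im (fst p)) in
     (vector [vector [s, Re (fst p) / s], vector [0, 1 / s]],
      vector [Im (snd p) / s, Re (snd p) / s], 0))"

lemma orbit_section_carrier:
  "p \<in> siegel_jacobi \<Longrightarrow> orbit_section p \<in> carrier jacobi_group"
  by (auto simp: siegel_jacobi_def jacobi_group_def orbit_section_def Let_def det_2)

lemma base_orbit_section:
  "p \<in> siegel_jacobi \<Longrightarrow> base_orbit (orbit_section p) = p"
  by (auto simp: siegel_jacobi_def base_orbit_def orbit_section_def Let_def complex_eq_iff
      field_simps simp flip: of_real_mult of_real_add)

text \<open>Expand each quotient by the conjugate of the automorphy factor \<open>j\<close>;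
  \<open>det M = 1\<close> makes the numerator of the imaginary part of \<open>\<tau>\<close> equal
  to 1.\<close>

lemma
  assumes M: "det M = 1"
  shows Re_fst_base_orbit: "Re (fst (base_orbit (M, X, \<kappa>))) =
      (M $ 1 $ 1 * M $ 2 $ 1 + M $ 1 $ 2 * M $ 2 $ 2) / ((M $ 2 $ 1)\<^sup>2 + (M $ 2 $ 2)\<^sup>2)"
    and Im_fst_base_orbit: "Im (fst (base_orbit (M, X, \<kappa>))) = 1 / ((M $ 2 $ 1)\<^sup>2 + (M $ 2 $ 2)\<^sup>2)"
    and Re_snd_base_orbit: "Re (snd (base_orbit (M, X, \<kappa>))) =
      (X $ 1 * M $ 2 $ 1 + X $ 2 * M $ 2 $ 2) / ((M $ 2 $ 1)\<^sup>2 + (M $ 2 $ 2)\<^sup>2)"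
    and Im_snd_base_orbit: "Im (snd (base_orbit (M, X, \<kappa>))) =
      (X $ 1 * M $ 2 $ 2 - X $ 2 * M $ 2 $ 1) / ((M $ 2 $ 1)\<^sup>2 + (M $ 2 $ 2)\<^sup>2)"
  using M by (simp_all add: base_orbit_def Let_def Re_divide Im_divide det_2 algebra_simps)

lemma det_1_row_nonzero:
  fixes M :: "real^2^2"
  assumes "det M = 1"
  shows "(M $ 2 $ 1)\<^sup>2 + (M $ 2 $ 2)\<^sup>2 > 0"
proof -
  have "M $ 2 $ 1 \<noteq> 0 \<or> M $ 2 $ 2 \<noteq> 0"
    using assms by (auto simp: det_2)
  then show ?thesis
    by (metis sum_power2_gt_zero_iff)
qed

lemma base_orbit_in_siegel_jacobi:
  "g \<in> carrier jacobi_group \<Longrightarrow> base_orbit g \<in> siegel_jacobi"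
  using det_1_row_nonzero
  by (cases g) (auto simp: jacobi_group_def siegel_jacobi_def case_prod_beta Im_fst_base_orbit)

text \<open>The denominators \<open>n\<close> all cancel, leaving polynomials in the group entries
  that can be compared with \<open>coAd\<close>.\<close>

lemma momentum_map_base_orbit:
  fixes M :: "real^2^2" and X :: "real^2"
  assumes M: "det M = 1"
  defines "Q \<equiv> (X $ 1 * M $ 2 $ 2 - X $ 2 * M $ 2 $ 1) / 2"
    and "P \<equiv> (X $ 1 * M $ 1 $ 2 - X $ 2 * M $ 1 $ 1) / 2"
  shows "momentum_map (base_orbit (M, X, \<kappa>)) = covector
    (- Q\<^sup>2 - ((M $ 2 $ 1)\<^sup>2 + (M $ 2 $ 2)\<^sup>2) / 2)
    (P\<^sup>2 + ((M $ 1 $ 1)\<^sup>2 + (M $ 1 $ 2)\<^sup>2) / 2)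
    (- 2 * P * Q - (M $ 1 $ 1 * M $ 2 $ 1 + M $ 1 $ 2 * M $ 2 $ 2)) P Q (- 1 / 4)"
proof -
  let ?p = "base_orbit (M, X, \<kappa>)"
  define n where "n = (M $ 2 $ 1)\<^sup>2 + (M $ 2 $ 2)\<^sup>2"
  note n = det_1_row_nonzero[OF M, folded n_def]
  note coords = Re_fst_base_orbit[OF M, of X \<kappa>, folded n_def] Im_fst_base_orbit[OF M, of X \<kappa>, folded n_def]
    Re_snd_base_orbit[OF M, of X \<kappa>, folded n_def] Im_snd_base_orbit[OF M, of X \<kappa>, folded n_def]
  have d: "M $ 1 $ 1 * M $ 2 $ 2 - M $ 1 $ 2 * M $ 2 $ 1 = 1"
    using M by (simp add: det_2)
  have Q: "JQ ?p = Q"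
    using n by (simp add: JQ_eq coords Q_def)
  have "(M $ 1 $ 1 * M $ 2 $ 1 + M $ 1 $ 2 * M $ 2 $ 2) * (X $ 1 * M $ 2 $ 2 - X $ 2 * M $ 2 $ 1)
      - (X $ 1 * M $ 2 $ 1 + X $ 2 * M $ 2 $ 2) = n * (X $ 1 * M $ 1 $ 2 - X $ 2 * M $ 1 $ 1)"
    unfolding n_def using d by algebra
  moreover have "JP ?p = ((M $ 1 $ 1 * M $ 2 $ 1 + M $ 1 $ 2 * M $ 2 $ 2)
        * (X $ 1 * M $ 2 $ 2 - X $ 2 * M $ 2 $ 1)
      - (X $ 1 * M $ 2 $ 1 + X $ 2 * M $ 2 $ 2)) / (2 * n)"
    unfolding JP_eq Q coords Q_def using n by (simp add: field_simps)
  ultimately have P: "JP ?p = P"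
    using n by (simp add: P_def)
  \<comment> \<open>Lagrange's identity for the two rows, with the squared determinant equal to
    1.\<close>
  have "(M $ 1 $ 1 * M $ 2 $ 1 + M $ 1 $ 2 * M $ 2 $ 2)\<^sup>2 + 1 = n * ((M $ 1 $ 1)\<^sup>2 + (M $ 1 $ 2)\<^sup>2)"
    unfolding n_def using d by algebra
  then have G: "JG ?p = P\<^sup>2 + ((M $ 1 $ 1)\<^sup>2 + (M $ 1 $ 2)\<^sup>2) / 2"
    using n by (simp add: JG_eq P coords field_simps power2_eq_square)
  show ?thesis
    using n by (simp add: momentum_map_covector Q P G JF_eq JH_eq coords JR_def n_def)
qed

lemma matrix_inv_2:
  fixes M :: "real^2^2"
  assumes "det M = 1"
  shows "matrix_inv M = vector [vector [M $ 2 $ 2, - M $ 1 $ 2], vector [- M $ 2 $ 1, M $ 1 $ 1]]"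
    (is "_ = ?N")
proof -
  have "?N ** M = mat 1"
    using assms by (simp add: vec_eq_iff forall_2 matrix_matrix_mult_def sum_2 mat_def det_2 algebra_simps)
  then show ?thesis
    using matrix_mul_assoc[of ?N M "matrix_inv M"] by (simp add: matrix_inv_det_1(2)[OF assms])
qed

text \<open>Equivariance at the base point. \<open>coAd g\<close> uses \<open>Ad\<close> of the
  inverse of \<open>g\<close>, whose matrix part is \<open>?N\<close>; the matrix inverse in
  \<open>Ad_eq\<close> is therefore \<open>M\<close> again.\<close>

lemma coAd_base_point:
  assumes "g \<in> carrier jacobi_group"
  shows "coAd g (momentum_map (\<i>, 0)) = momentum_map (base_orbit g)"
proof (rule blinfun_eqI)
  fix L :: jacobi_algebra
  obtain M X \<kappa> where g: "g = (M, X, \<kappa>)" and M: "det M = 1"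
    using assms by (cases g) (auto simp: jacobi_group_def)
  obtain A \<xi> r where L: "L = (A, \<xi>, r)"
    by (cases L)
  let ?N = "matrix_inv M"
  note N = matrix_inv_det_1(3)[OF M]
  have inv: "matrix_inv ?N = M"
    using matrix_inv_det_1[OF M] matrix_inv_det_1[OF N]
    using matrix_mul_assoc[of M ?N "matrix_inv ?N"] by simp
  have base: "momentum_map (\<i>, 0) = covector (- 1 / 2) (1 / 2) 0 0 0 (- 1 / 4)"
    by (simp add: momentum_map_covector JF_eq JG_eq JH_eq JP_eq JQ_eq JR_def)
  show "blinfun_apply (coAd g (momentum_map (\<i>, 0))) L = blinfun_apply (momentum_map (base_orbit g)) L"
    unfolding coAd_apply[OF assms] unfolding g inv_jacobi_group[OF M] L base covector_apply
      Ad_eq[OF N] inv momentum_map_base_orbit[OF M]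
    by (simp add: matrix_inv_2[OF M] Rep_sl2_diag \<Omega>_def matrix_matrix_mult_def
        vector_matrix_mult_def sum_2) (simp add: field_simps power2_eq_square)
qed

text \<open>The coordinates are recovered successively: \<open>v\<close> from \<open>JF\<close> and
  \<open>JQ\<close>, \<open>u\<close> from \<open>JH\<close>, \<open>y\<close> from
  \<open>JQ\<close>, \<open>x\<close> from \<open>JP\<close>.\<close>

lemma inj_on_momentum_map: "inj_on momentum_map siegel_jacobi"
proof (rule inj_onI)
  fix p q
  assume pq: "p \<in> siegel_jacobi" "q \<in> siegel_jacobi" and eq: "momentum_map p = momentum_map q"
  have J: "JF p = JF q" "JH p = JH q" "JP p = JP q" "JQ p = JQ q"
    using covector_inject eq by (auto simp: momentum_map_covector)
  have pos: "Im (fst p) > 0" "Im (fst q) > 0"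
    using pq by (auto simp: siegel_jacobi_def)
  have v: "Im (fst p) = Im (fst q)"
    using J(1,4) by (simp add: JF_eq)
  moreover have u: "Re (fst p) = Re (fst q)"
    using J pos by (simp add: JH_eq v)
  moreover have "Im (snd p) = Im (snd q)"
    using J(4) pos by (simp add: JQ_eq v)
  moreover have "Re (snd p) = Re (snd q)"
    using J(3,4) by (simp add: JP_eq u)
  ultimately show "p = q"
    by (simp add: prod_eq_iff complex_eq_iff)
qed

lemma momentum_map_orbit_section:
  "p \<in> siegel_jacobi \<Longrightarrow> momentum_map p = coAd (orbit_section p) (momentum_map (\<i>, 0))"
  by (simp add: coAd_base_point orbit_section_carrier base_orbit_section)

lemma bij_betw_momentum_map:
  "bij_betw momentum_map siegel_jacobi (coadjoint_orbit (momentum_map (\<i>, 0)))"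
proof -
  have "momentum_map ` siegel_jacobi = coadjoint_orbit (momentum_map (\<i>, 0))"
  proof (intro equalityI subsetI)
    fix \<alpha> assume "\<alpha> \<in> momentum_map ` siegel_jacobi"
    then show "\<alpha> \<in> coadjoint_orbit (momentum_map (\<i>, 0))"
      unfolding coadjoint_orbit_def using momentum_map_orbit_section orbit_section_carrier by blast
  next
    fix \<alpha> assume "\<alpha> \<in> coadjoint_orbit (momentum_map (\<i>, 0))"
    then show "\<alpha> \<in> momentum_map ` siegel_jacobi"
      unfolding coadjoint_orbit_def using coAd_base_point base_orbit_in_siegel_jacobi by blast
  qed
  then show ?thesis
    using inj_on_momentum_map by (simp add: bij_betw_def)
qed

section \<open>Smoothness of the bijection and of its inverse\<close>

lemma open_siegel_jacobi: "open siegel_jacobi"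
proof -
  have eq: "siegel_jacobi = {p. 0 < Im (fst p)}"
    by (auto simp: siegel_jacobi_def)
  show ?thesis
    unfolding eq by (intro open_Collect_less continuous_intros)
qed

lemma smooth_on_orbit_section: "smooth_on siegel_jacobi orbit_section"
proof (rule smooth_on_openI[OF open_siegel_jacobi])
  fix n
  note op = open_siegel_jacobi
  have pos: "Im (fst p) > 0" if "p \<in> siegel_jacobi" for p
    using that by (auto simp: siegel_jacobi_def)
  have lin: "bounded_linear (\<lambda>p :: complex \<times> complex. Im (fst p))" "bounded_linear (\<lambda>p :: complex \<times> complex. Re (fst p))"
    "bounded_linear (\<lambda>p :: complex \<times> complex. Im (snd p))" "bounded_linear (\<lambda>p :: complex \<times> complex. Re (snd p))"
    by (intro bounded_linear_compose[OF bounded_linear_Im] bounded_linear_compose[OF bounded_linear_Re]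
        bounded_linear_fst bounded_linear_snd)+
  let ?s = "\<lambda>p :: complex \<times> complex. sqrt (Im (fst p))"
  have s: "Ck_on n siegel_jacobi ?s"
    by (intro Ck_on_sqrt op pos Ck_on_bounded_linear lin)
  have s': "Ck_on n siegel_jacobi (\<lambda>p. f p / ?s p)" if "bounded_linear f" for f
    by (intro Ck_on_divide op Ck_on_bounded_linear that s) (use pos in force)
  have i: "Ck_on n siegel_jacobi (\<lambda>p. 1 / ?s p)"
    by (intro Ck_on_divide op Ck_on_const s) (use pos in force)
  \<comment> \<open>Written as smooth scalars times constant vectors and matrices, the section is
    covered by the closure rules.\<close>
  have eq: "orbit_section = (\<lambda>p. (?s p *\<^sub>R vector [vector [1, 0], 0]
      + (Re (fst p) / ?s p) *\<^sub>R vector [vector [0, 1], 0] + (1 / ?s p) *\<^sub>R vector [0, vector [0, 1]],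
      (Im (snd p) / ?s p) *\<^sub>R vector [1, 0] + (Re (snd p) / ?s p) *\<^sub>R vector [0, 1], 0))"
    by (auto simp: fun_eq_iff orbit_section_def Let_def vec_eq_iff forall_2)
  show "Ck_on n siegel_jacobi orbit_section"
    unfolding eq by (intro Ck_on_Pair Ck_on_add Ck_on_scaleR Ck_on_const op s i s' lin)
qed

text \<open>A rational map is smooth where its denominator is nonzero; this open subset of the
  ambient space contains the group, since \<open>det M = 1\<close> forbids a zero second
  row.\<close>

lemma smooth_on_base_orbit: "smooth_on (carrier jacobi_group) base_orbit"
proof -
  let ?j = "\<lambda>g :: jacobi_ambient. of_real (fst g $ 2 $ 1) * \<i> + of_real (fst g $ 2 $ 2)"
  let ?U = "{g. ?j g \<noteq> 0}"
  have op: "open ?U"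
    by (intro open_Collect_neq continuous_intros)
  have lin: "bounded_linear (\<lambda>g :: jacobi_ambient. complex_of_real (fst g $ i $ j))"
    "bounded_linear (\<lambda>g :: jacobi_ambient. complex_of_real (fst (snd g) $ i))" for i j
    by (intro bounded_linear_compose[OF bounded_linear_of_real]
        bounded_linear_compose[OF bounded_linear_vec_nth] bounded_linear_fst
        bounded_linear_fst_comp bounded_linear_snd)+
  have eq: "base_orbit = (\<lambda>g. ((of_real (fst g $ 1 $ 1) * \<i> + of_real (fst g $ 1 $ 2)) / ?j g,
      (of_real (fst (snd g) $ 1) * \<i> + of_real (fst (snd g) $ 2)) / ?j g))"
    by (auto simp: fun_eq_iff base_orbit_def Let_def)
  have "Ck_on n ?U base_orbit" for n
    unfolding eq
    by (intro Ck_on_Pair Ck_on_divide Ck_on_add Ck_on_mult Ck_on_const Ck_on_bounded_linear lin op) auto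
  moreover have "carrier jacobi_group \<subseteq> ?U"
    by (auto simp: jacobi_group_def complex_eq_iff det_2)
  ultimately show ?thesis
    unfolding smooth_on_def using op by blast
qed

lemma diffeomorphism_momentum_map:
  "diffeomorphism_onto_orbit (momentum_map (\<i>, 0)) siegel_jacobi momentum_map"
  unfolding diffeomorphism_onto_orbit_def
proof (intro conjI bij_betw_momentum_map)
  show "smooth_into_orbit (momentum_map (\<i>, 0)) siegel_jacobi momentum_map"
    unfolding smooth_into_orbit_def
    using smooth_on_orbit_section orbit_section_carrier momentum_map_orbit_section
    by (intro ballI exI[of _ UNIV] exI[of _ orbit_section]) auto
  \<comment> \<open>By equivariance and injectivity, the inverse composed with the orbit map is
    \<open>base_orbit\<close>.\<close>
  have "inv_into siegel_jacobi momentum_map (coAd g (momentum_map (\<i>, 0))) = base_orbit g"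
    if "g \<in> carrier jacobi_group" for g
    using that by (simp add: coAd_base_point base_orbit_in_siegel_jacobi inj_on_momentum_map)
  then show "smooth_from_orbit (momentum_map (\<i>, 0)) (inv_into siegel_jacobi momentum_map)"
    using smooth_on_base_orbit unfolding smooth_from_orbit_def smooth_on_def by auto
qed

subsection \<open>The derivative of the momentum map\<close>

lemma has_derivative_covector:
  assumes "(a has_derivative a') F" "(b has_derivative b') F" "(c has_derivative c') F"
    "(d has_derivative d') F" "(e has_derivative e') F"
  shows "((\<lambda>p. covector (a p) (b p) (c p) (d p) (e p) r) has_derivative
    (\<lambda>X. covector (a' X) (b' X) (c' X) (d' X) (e' X) 0)) F"
  unfolding covector_expand[of "a _"] covector_expand[of "a' _"] scaleR_zero_left
  by (intro has_derivative_add has_derivative_scaleR_left has_derivative_const assms)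

definition JQ_deriv :: "complex \<times> complex \<Rightarrow> complex \<times> complex \<Rightarrow> real" where
  "JQ_deriv p X = Im (snd X) / (2 * Im (fst p)) - Im (snd p) * Im (fst X) / (2 * (Im (fst p))\<^sup>2)"

text \<open>Derivatives of \<open>JQ\<close> and \<open>JP\<close> stay unexpanded here and in the
  formulas below, so that \<open>P\<close> and \<open>Q\<close> can later serve as
  coordinates.\<close>

definition JP_deriv :: "complex \<times> complex \<Rightarrow> complex \<times> complex \<Rightarrow> real" where
  "JP_deriv p X = Re (fst X) * JQ p + Re (fst p) * JQ_deriv p X - Re (snd X) / 2"

definition JF_deriv :: "complex \<times> complex \<Rightarrow> complex \<times> complex \<Rightarrow> real" where
  "JF_deriv p X = - 2 * JQ p * JQ_deriv p X + Im (fst X) / (2 * (Im (fst p))\<^sup>2)"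

definition JG_deriv :: "complex \<times> complex \<Rightarrow> complex \<times> complex \<Rightarrow> real" where
  "JG_deriv p X = 2 * JP p * JP_deriv p X + Re (fst p) * Re (fst X) / Im (fst p)
    + Im (fst X) / 2 - (Re (fst p))\<^sup>2 * Im (fst X) / (2 * (Im (fst p))\<^sup>2)"

definition JH_deriv :: "complex \<times> complex \<Rightarrow> complex \<times> complex \<Rightarrow> real" where
  "JH_deriv p X = - 2 * (JP_deriv p X * JQ p + JP p * JQ_deriv p X)
    - Re (fst X) / Im (fst p) + Re (fst p) * Im (fst X) / (Im (fst p))\<^sup>2"

definition momentum_deriv :: "complex \<times> complex \<Rightarrow> complex \<times> complex \<Rightarrow> jacobi_dual" where
  "momentum_deriv p X = covector (JF_deriv p X) (JG_deriv p X) (JH_deriv p X) (JP_deriv p X) (JQ_deriv p X) 0"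

lemma momentum_map_has_derivative:
  assumes "p \<in> siegel_jacobi"
  shows "(momentum_map has_derivative momentum_deriv p) (at p)"
proof -
  have v: "Im (fst p) \<noteq> 0"
    using assms by (auto simp: siegel_jacobi_def)
  have Q: "(JQ has_derivative JQ_deriv p) (at p)"
    unfolding JQ_eq[abs_def] JQ_deriv_def[abs_def]
    by (rule derivative_eq_intros refl | (use v in simp; fail))+
      (use v in \<open>auto simp: fun_eq_iff field_simps power2_eq_square\<close>)
  have P: "(JP has_derivative JP_deriv p) (at p)"
    unfolding JP_eq[abs_def] JP_deriv_def[abs_def]
    by (rule derivative_eq_intros refl Q | (simp; fail))+ (auto simp: fun_eq_iff)
  have F: "(JF has_derivative JF_deriv p) (at p)"
    unfolding JF_eq[abs_def] JF_deriv_def[abs_def]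
    by (rule derivative_eq_intros refl Q | (use v in simp; fail))+
      (use v in \<open>auto simp: fun_eq_iff field_simps power2_eq_square\<close>)
  have G: "(JG has_derivative JG_deriv p) (at p)"
    unfolding JG_eq[abs_def] JG_deriv_def[abs_def]
    by (rule derivative_eq_intros refl P | (use v in simp; fail))+
      (use v in \<open>auto simp: fun_eq_iff field_simps power2_eq_square\<close>)
  have H: "(JH has_derivative JH_deriv p) (at p)"
    unfolding JH_eq[abs_def] JH_deriv_def[abs_def]
    by (rule derivative_eq_intros refl P Q | (use v in simp; fail))+
      (use v in \<open>auto simp: fun_eq_iff field_simps power2_eq_square\<close>)
  show ?thesis
    unfolding momentum_map_covector[abs_def] momentum_deriv_def[abs_def]
    by (rule has_derivative_covector[OF F G H P Q])
qed

lemma frechet_derivative_momentum_map: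
  "p \<in> siegel_jacobi \<Longrightarrow> frechet_derivative momentum_map (at p) = momentum_deriv p"
  using frechet_derivative_at[OF momentum_map_has_derivative] by simp

text \<open>The velocity at time \<open>0\<close> of the curve \<open>exp (- t L) \<cdot> p\<close>; with this sign the derivative of
  the momentum map turns it into \<open>coad L\<close>.\<close>

definition inf_action :: "jacobi_algebra \<Rightarrow> complex \<times> complex \<Rightarrow> complex \<times> complex" where
  "inf_action L p = (case (tangent_incl L, p) of ((A, \<xi>, s), (\<tau>, z)) \<Rightarrow>
     (of_real (A $ 2 $ 1) * \<tau>\<^sup>2 - of_real (2 * A $ 1 $ 1) * \<tau> - of_real (A $ 1 $ 2),
      of_real (A $ 2 $ 1) * \<tau> * z - of_real (A $ 1 $ 1) * z - of_real (\<xi> $ 1) * \<tau> - of_real (\<xi> $ 2)))"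

text \<open>Upper triangular matrices and translations already act transitively; the central
  component acts trivially and is set to 0.\<close>

lemma inf_action_surj:
  assumes "p \<in> siegel_jacobi"
  obtains \<alpha> \<beta> \<xi> where "X = inf_action (sl2_of \<alpha> \<beta> 0, \<xi>, 0) p"
proof -
  have v: "Im (fst p) \<noteq> 0"
    using assms by (auto simp: siegel_jacobi_def)
  \<comment> \<open>With lower left entry 0 the action is
    \<open>(- 2 \<alpha> \<tau> - \<beta>, - \<alpha> z - l \<tau> - m)\<close>; comparing real and
    imaginary parts gives a triangular linear system.\<close>
  define \<alpha> where "\<alpha> = - Im (fst X) / (2 * Im (fst p))"
  define \<beta> where "\<beta> = - Re (fst X) - 2 * \<alpha> * Re (fst p)"
  define l where "l = - (Im (snd X) + \<alpha> * Im (snd p)) / Im (fst p)"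
  define m where "m = - Re (snd X) - \<alpha> * Re (snd p) - l * Re (fst p)"
  have "X = inf_action (sl2_of \<alpha> \<beta> 0, vector [l, m], 0) p"
    using v by (intro prod_eqI complex_eqI)
      (simp_all add: inf_action_def case_prod_beta m_def \<beta>_def l_def \<alpha>_def)
  then show ?thesis
    by (rule that)
qed

text \<open>Infinitesimal equivariance: the five derivatives along the action are matched with the
  coefficients in \<open>coad_covector\<close>.\<close>

lemma momentum_deriv_inf_action:
  assumes "p \<in> siegel_jacobi"
  shows "momentum_deriv p (inf_action L p) = coad L (momentum_map p)"
proof -
  obtain A \<xi> s where L: "L = (A, \<xi>, s)"
    by (cases L)
  define u v x y where "u = Re (fst p)" and "v = Im (fst p)" and "x = Re (snd p)" and "y = Im (snd p)"
  have p: "p = (Complex u v, Complex x y)"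
    by (simp add: prod_eq_iff complex_eq_iff u_def v_def x_def y_def)
  have v: "v > 0"
    using assms by (simp add: p siegel_jacobi_def)
  define \<alpha> \<beta> \<gamma> l m where "\<alpha> = Rep_sl2 A $ 1 $ 1" and "\<beta> = Rep_sl2 A $ 1 $ 2" and "\<gamma> = Rep_sl2 A $ 2 $ 1"
    and "l = \<xi> $ 1" and "m = \<xi> $ 2"
  note entries = \<alpha>_def[symmetric] \<beta>_def[symmetric] \<gamma>_def[symmetric] l_def[symmetric] m_def[symmetric]
  define X where "X = inf_action L p"
  have X: "Re (fst X) = \<gamma> * (u\<^sup>2 - v\<^sup>2) - 2 * \<alpha> * u - \<beta>" "Im (fst X) = 2 * \<gamma> * u * v - 2 * \<alpha> * v"
    "Re (snd X) = \<gamma> * (u * x - v * y) - \<alpha> * x - l * u - m"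
    "Im (snd X) = \<gamma> * (u * y + v * x) - \<alpha> * y - l * v"
    by (simp_all add: X_def inf_action_def L p entries power2_eq_square algebra_simps)
  define P Q where "P = JP p" and "Q = JQ p"
  \<comment> \<open>Replacing \<open>x, y\<close> by \<open>P, Q\<close> makes the remaining
    identities short.\<close>
  have y: "y = 2 * v * Q" and x: "x = 2 * u * Q - 2 * P"
    using v by (simp_all add: Q_def P_def JP_eq JQ_eq p)
  have F: "JF p = - Q\<^sup>2 - 1 / (2 * v)" and G: "JG p = P\<^sup>2 + (u\<^sup>2 + v\<^sup>2) / (2 * v)"
    and H: "JH p = - 2 * P * Q - u / v"
    by (simp_all add: JF_eq JG_eq JH_eq p P_def Q_def)
  have dQ: "JQ_deriv p X = - \<gamma> * P + \<alpha> * Q - l / 2"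
    using v by (simp add: JQ_deriv_def X p) (simp add: x y field_simps power2_eq_square)
  have dP: "JP_deriv p X = - \<alpha> * P - \<beta> * Q + m / 2"
    by (simp add: JP_deriv_def dQ X flip: Q_def) (simp add: p x y field_simps power2_eq_square)
  have dF: "JF_deriv p X = 2 * \<alpha> * JF p - \<gamma> * JH p + l * Q"
    using v by (simp add: JF_deriv_def dQ X F H flip: Q_def) (simp add: p field_simps power2_eq_square)
  have dG: "JG_deriv p X = - 2 * \<alpha> * JG p + \<beta> * JH p + m * P"
    using v by (simp add: JG_deriv_def dP X G H flip: P_def) (simp add: p field_simps power2_eq_square)
  have dH: "JH_deriv p X = - 2 * \<beta> * JF p + 2 * \<gamma> * JG p + l * P - m * Q"
    using v by (simp add: JH_deriv_def dP dQ X F G flip: P_def Q_def) (simp add: p field_simps power2_eq_square)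
  have "momentum_deriv p X = coad L (momentum_map p)"
    unfolding momentum_deriv_def momentum_map_covector L coad_covector Let_def entries dF dG dH dP dQ
    by (simp add: JR_def P_def Q_def)
  then show ?thesis
    by (simp add: X_def)
qed

text \<open>Both inclusions rest on infinitesimal equivariance; the forward one also needs every
  tangent vector to be an infinitesimal action.\<close>

lemma range_momentum_deriv:
  assumes "p \<in> siegel_jacobi"
  shows "range (momentum_deriv p) = orbit_tangent (momentum_map p)"
proof (intro equalityI subsetI)
  fix \<alpha> assume "\<alpha> \<in> range (momentum_deriv p)"
  then obtain X where "\<alpha> = momentum_deriv p X"
    by blast
  then show "\<alpha> \<in> orbit_tangent (momentum_map p)"
    unfolding orbit_tangent_def using inf_action_surj[OF assms] momentum_deriv_inf_action[OF assms]
    by (metis rangeI)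
next
  fix \<alpha> assume "\<alpha> \<in> orbit_tangent (momentum_map p)"
  then show "\<alpha> \<in> range (momentum_deriv p)"
    unfolding orbit_tangent_def using momentum_deriv_inf_action[OF assms]
    by (metis (no_types, lifting) imageE rangeI)
qed

section \<open>Comparison of the two symplectic forms\<close>

lemma vector_4:
  "(vector [a, b, c, d] :: 'a::zero^4) $ 1 = a" "(vector [a, b, c, d] :: 'a^4) $ 2 = b"
  "(vector [a, b, c, d] :: 'a^4) $ 3 = c" "(vector [a, b, c, d] :: 'a^4) $ 4 = d"
  unfolding vector_def by simp_all

text \<open>The three brackets are the 2-forms \<open>du dv\<close>, \<open>du dy + dx dv\<close>
  and \<open>dx dy\<close> (wedge products).\<close>

lemma \<omega>_KB_eq:
  "\<omega>_KB (\<tau>, z) (X1, X2) (Y1, Y2) =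
    ((Im \<tau> + (Im z)\<^sup>2) / Im \<tau> ^ 3 * (Re X1 * Im Y1 - Im X1 * Re Y1)
      - Im z / (Im \<tau>)\<^sup>2 * (Re X1 * Im Y2 - Im X1 * Re Y2 + Re X2 * Im Y1 - Im X2 * Re Y1)
      + 1 / Im \<tau> * (Re X2 * Im Y2 - Im X2 * Re Y2)) / 2"
  by (simp add: \<omega>_KB_def g_KB_def KB_matrix_def Let_def complex_structure_def real_coords_def
      inner_vec_def matrix_vector_mult_def sum_4 vector_4) (simp add: algebra_simps diff_divide_distrib add_divide_distrib)

lemma pullback_momentum_map:
  assumes p: "p \<in> siegel_jacobi"
  shows "pullback momentum_map KKS_form p X Y = \<omega>_KB p X Y"
proof -
  obtain a b \<xi> where X: "X = inf_action (sl2_of a b 0, \<xi>, 0) p"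
    by (rule inf_action_surj[OF p])
  obtain a' b' \<xi>' where Y: "Y = inf_action (sl2_of a' b' 0, \<xi>', 0) p"
    by (rule inf_action_surj[OF p])
  have "pullback momentum_map KKS_form p X Y =
      blinfun_apply (momentum_map p) (jacobi_bracket (sl2_of a b 0, \<xi>, 0) (sl2_of a' b' 0, \<xi>', 0))"
    unfolding pullback_def frechet_derivative_momentum_map[OF p] X Y
      momentum_deriv_inf_action[OF p] KKS_form_coad ..
  \<comment> \<open>The commutator of two upper triangular traceless matrices is a multiple of F, so
    \<open>JG\<close> and \<open>JH\<close> do not occur; the last term is \<open>2 \<Omega>\<close>
    times \<open>JR\<close>.\<close>
  also have "\<dots> = 2 * (a * b' - b * a') * JF p + (\<xi> $ 1 * a' - \<xi>' $ 1 * a) * JP p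
      + (\<xi> $ 1 * b' - \<xi> $ 2 * a' - \<xi>' $ 1 * b + \<xi>' $ 2 * a) * JQ p - (\<xi> $ 1 * \<xi>' $ 2 - \<xi> $ 2 * \<xi>' $ 1) / 2"
    by (simp add: momentum_map_apply sl2_bracket.rep_eq matrix_matrix_mult_def vector_matrix_mult_def
        sum_2 \<Omega>_def JR_def field_simps)
  also have "\<dots> = \<omega>_KB p X Y"
  proof (cases p)
    case (Pair \<tau> z)
    have v: "Im \<tau> > 0"
      using p by (simp add: Pair siegel_jacobi_def)
    show ?thesis
      unfolding X Y JF_eq JP_eq JQ_eq inf_action_def Pair using v
      by (simp add: \<omega>_KB_eq) (simp add: field_simps power2_eq_square power3_eq_cube)
  qed
  finally show ?thesis .
qed

theorem proposition3p47:
  shows "\<exists>\<mu>. diffeomorphism_onto_orbit \<mu> siegel_jacobi momentum_map \<and>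
    (\<forall>p\<in>siegel_jacobi. range (frechet_derivative momentum_map (at p)) = orbit_tangent (momentum_map p)) \<and>
    (\<forall>p\<in>siegel_jacobi. \<forall>X Y. pullback momentum_map KKS_form p X Y = \<omega>_KB p X Y)"
  using diffeomorphism_momentum_map range_momentum_deriv pullback_momentum_map
  by (auto simp: frechet_derivative_momentum_map)

end
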